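(* There exists a locally checkable problem whose round complexity in $n$-node graphs, in the LOCAL model, is $\Theta(\log\log n)$. Moreover, the lower bound $\Omega(\log\log n)$ for this problem also holds when the input graphs are restricted to be trees.
   Context: LOCAL model. The network is a simple connected graph $G=(V,E)$ with $n\ge 1$ nodes. Each node $v$ has an identifier $\mathrm{id}(v)\in[0,N]$, unique in the network, where $N$ is an upper bound on $n$ that is polynomial in $n$; $N$ may be given to the nodes. Initially a node knows only its identifier, its degree and its input label (and $N$), and nothing else about the graph. Computation proceeds in synchronous rounds, all nodes starting at the same round; in each round every node performs arbitrary local computation, sends a message of arbitrary size to each neighbor, and receives its neighbors' messages. Each node eventually outputs a label. The round complexity of a (deterministic) algorithm is the function of $n$ giving the maximum, over all $n$-node graphs (and all identifier and input assignments), of the number of rounds until all nodes have output. Locally checkable problem. A pair $(L,\varphi)$ where $L$ is a finite set of labels and $\varphi$ is a Boolean predicate on $L$-labeled balls of radius $r$ (for some fixed integer $r\ge 0$) in arbitrary graphs (no bound on the degrees); the ball of radius $r$ centered at $v$ is the subgraph induced by the nodes at distance at most $r$ from $v$. Input labels are allowed: $L=L_{in}\times L_{out}$, each node $v$ receives an arbitrary $\ell_{in}(v)\in L_{in}$ and must output $\ell_{out}(v)\in L_{out}$. An algorithm solves the problem if for every input graph and every input labeling the produced labeling is such that the labeled ball of radius $r$ around every node satisfies $\varphi$. A problem has round complexity $\Theta(t(n))$ if some algorithm solves it in $O(t(n))$ rounds and every algorithm solving it has round complexity $\Omega(t(n))$. The lower bound holds for trees if every algorithm solving the problem on all trees needs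 $\Omega(t(n))$ rounds in the worst case over $n$-node trees. Logarithms are in base $2$. *)

theory Defs
  imports
    Complex_Main
    "HOL-Library.Extended_Real"
    "HOL-Computational_Algebra.Polynomial"
    "Graph_Theory.Pair_Digraph"
    "Graph_Theory.Digraph_Component"
begin

section \<open>Graphs\<close>

text \<open>
  A finite simple undirected graph is a \<^locale>\<open>pair_graph\<close>: a finite, symmetric, loop-free digraph
  whose arcs are pairs of nodes. Nodes are natural numbers; these names carry no information, since
  they are visible neither to algorithms nor (see \<open>iso_invariant\<close> below) to local predicates.
\<close>

type_synonym ugraph = "nat pair_pre_digraph"

definition neighbors :: "ugraph \<Rightarrow> nat \<Rightarrow> nat set" where
  "neighbors G v = {u. (v, u) \<in> parcs G}"

definition deg :: "ugraph \<Rightarrow> nat \<Rightarrow> nat" where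
  "deg G v = card (neighbors G v)"

definition connected_graph :: "ugraph \<Rightarrow> bool" where
  "connected_graph G \<longleftrightarrow> pair_graph G \<and> Digraph_Component.connected (with_proj G)"

text \<open>
  The library's \<^const>\<open>Digraph_Component.tree\<close> is unsuitable here: in a symmetric digraph every edge
  gives a directed cycle of length 2. The cycles of the undirected graph are those of length
  at least 3.
\<close>

definition tree_graph :: "ugraph \<Rightarrow> bool" where
  "tree_graph G \<longleftrightarrow> connected_graph G \<and>
     \<not> (\<exists>p. pre_digraph.cycle (with_proj G) p \<and> 3 \<le> length p)"

definition ball_nodes :: "ugraph \<Rightarrow> nat \<Rightarrow> nat \<Rightarrow> nat set" where
  "ball_nodes G r v = {u. \<exists>p. pre_digraph.awalk (with_proj G) v p u \<and> length p \<le> r}"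

definition ball_graph :: "ugraph \<Rightarrow> nat \<Rightarrow> nat \<Rightarrow> ugraph" where
  "ball_graph G r v =
     \<lparr> pverts = ball_nodes G r v,
       parcs = parcs G \<inter> (ball_nodes G r v \<times> ball_nodes G r v) \<rparr>"


section \<open>Locally checkable problems\<close>

text \<open>A local predicate is applied to a graph, its center, and an (input, output) labeling.\<close>

type_synonym local_pred = "ugraph \<Rightarrow> nat \<Rightarrow> (nat \<Rightarrow> nat \<times> nat) \<Rightarrow> bool"

record problem =
  in_labels :: "nat set"
  out_labels :: "nat set"
  radius :: nat
  lpred :: local_pred

text \<open>
  A predicate on centered labeled graphs depends only on their isomorphism type; in particular
  (take \<open>f\<close> to be the identity) it ignores the labels outside the given graph.
\<close>

definition iso_invariant :: "local_pred \<Rightarrow> bool" where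
  "iso_invariant \<phi> \<longleftrightarrow>
     (\<forall>H H' f c l l'.
        pair_graph H \<and> pair_graph H' \<and> c \<in> pverts H \<and>
        bij_betw f (pverts H) (pverts H') \<and>
        (\<forall>u\<in>pverts H. \<forall>w\<in>pverts H. (u, w) \<in> parcs H \<longleftrightarrow> (f u, f w) \<in> parcs H') \<and>
        (\<forall>u\<in>pverts H. l' (f u) = l u)
        \<longrightarrow> \<phi> H c l = \<phi> H' (f c) l')"

definition locally_checkable :: "problem \<Rightarrow> bool" where
  "locally_checkable P \<longleftrightarrow>
     finite (in_labels P) \<and> finite (out_labels P) \<and> iso_invariant (lpred P)"

definition valid_labeling :: "problem \<Rightarrow> ugraph \<Rightarrow> (nat \<Rightarrow> nat) \<Rightarrow> (nat \<Rightarrow> nat) \<Rightarrow> bool" where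
  "valid_labeling P G lin lout \<longleftrightarrow>
     (\<forall>v\<in>pverts G. lout v \<in> out_labels P \<and>
        lpred P (ball_graph G (radius P) v) v (\<lambda>u. (lin u, lout u)))"


section \<open>Networks\<close>

text \<open>
  A node addresses its neighbors through ports \<open>0, ..., deg - 1\<close>; \<open>port I v i\<close> is the neighbor
  of \<open>v\<close> behind its port \<open>i\<close>. The numbering is arbitrary (hence chosen by the adversary) and says
  nothing about the neighbors.
\<close>

record network =
  topology :: ugraph
  port :: "nat \<Rightarrow> nat \<Rightarrow> nat"
  ident :: "nat \<Rightarrow> nat"
  id_bound :: nat
  input :: "nat \<Rightarrow> nat"

text \<open>
  The bound \<open>N\<close> is at least the number \<open>n\<close> of nodes and polynomial in \<open>n\<close>: the polynomial \<open>q\<close> is a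
  parameter of the model, and \<open>N\<close> may be any value between \<open>n\<close> and \<open>q(n)\<close>.
\<close>

definition admissible_poly :: "nat poly \<Rightarrow> bool" where
  "admissible_poly q \<longleftrightarrow> (\<forall>n\<ge>1. n \<le> poly q n)"

definition networks :: "(ugraph \<Rightarrow> bool) \<Rightarrow> nat poly \<Rightarrow> problem \<Rightarrow> network set" where
  "networks C q P = {I.
     let G = topology I in
       connected_graph G \<and> C G \<and>
       (\<forall>v\<in>pverts G. bij_betw (port I v) {..<deg G v} (neighbors G v)) \<and>
       inj_on (ident I) (pverts G) \<and> ident I ` pverts G \<subseteq> {0..id_bound I} \<and>
       card (pverts G) \<le> id_bound I \<and> id_bound I \<le> poly q (card (pverts G)) \<and>
       input I ` pverts G \<subseteq> in_labels P}"


section \<open>Algorithms in the LOCAL model\<close>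

text \<open>
  Messages are bit strings of arbitrary length. A node's knowledge consists of its initial knowledge
  and of everything it has received: \<open>received k ! t ! i\<close> is the message that arrived through port
  \<open>i\<close> in round \<open>t + 1\<close>. A deterministic node that performs arbitrary local computation is thus given
  by arbitrary functions of its knowledge: the message sent next through each port, and the output
  label, if the node has already decided on one. A node that has output keeps exchanging messages.
\<close>

type_synonym message = "bool list"

record knowledge =
  known_bound :: nat
  own_id :: nat
  own_deg :: nat
  own_input :: nat
  received :: "message list list"

record algorithm =
  send :: "knowledge \<Rightarrow> nat \<Rightarrow> message"
  decide :: "knowledge \<Rightarrow> nat option"

definition initial_knowledge :: "network \<Rightarrow> nat \<Rightarrow> knowledge" where
  "initial_knowledge I v =
     \<lparr> known_bound = id_bound I, own_id = ident I v, own_deg = deg (topology I) v,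
       own_input = input I v, received = [] \<rparr>"

definition port_to :: "network \<Rightarrow> nat \<Rightarrow> nat \<Rightarrow> nat" where
  "port_to I u v = the_inv_into {..<deg (topology I) u} (port I u) v"

fun knowledge_after :: "algorithm \<Rightarrow> network \<Rightarrow> nat \<Rightarrow> nat \<Rightarrow> knowledge" where
  "knowledge_after A I 0 v = initial_knowledge I v"
| "knowledge_after A I (Suc t) v =
     (knowledge_after A I t v)
       \<lparr> received := received (knowledge_after A I t v) @
           [map (\<lambda>i. let u = port I v i in send A (knowledge_after A I t u) (port_to I u v))
              [0..<deg (topology I) v]] \<rparr>"

definition has_output :: "algorithm \<Rightarrow> network \<Rightarrow> nat \<Rightarrow> nat \<Rightarrow> bool" where
  "has_output A I v t \<longleftrightarrow> decide A (knowledge_after A I t v) \<noteq> None"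

text \<open>A node's output is irrevocable: only its first decision counts.\<close>

definition output_label :: "algorithm \<Rightarrow> network \<Rightarrow> nat \<Rightarrow> nat" where
  "output_label A I v = the (decide A (knowledge_after A I (LEAST t. has_output A I v t) v))"

text \<open>The number of rounds until all nodes have output (infinite if some node never does).\<close>

definition rounds :: "algorithm \<Rightarrow> network \<Rightarrow> enat" where
  "rounds A I = (SUP v\<in>pverts (topology I). INF t\<in>{t. has_output A I v t}. enat t)"

definition solves :: "(ugraph \<Rightarrow> bool) \<Rightarrow> nat poly \<Rightarrow> problem \<Rightarrow> algorithm \<Rightarrow> bool" where
  "solves C q P A \<longleftrightarrow>
     (\<forall>I\<in>networks C q P.
        (\<forall>v\<in>pverts (topology I). \<exists>t. has_output A I v t) \<and>
        valid_labeling P (topology I) (input I) (output_label A I))"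

definition round_complexity ::
    "(ugraph \<Rightarrow> bool) \<Rightarrow> nat poly \<Rightarrow> problem \<Rightarrow> algorithm \<Rightarrow> nat \<Rightarrow> enat" where
  "round_complexity C q P A n =
     (SUP I\<in>{I\<in>networks C q P. card (pverts (topology I)) = n}. rounds A I)"


section \<open>Complexity of problems\<close>

text \<open>
  Round complexities are suprema in \<^typ>\<open>enat\<close>, to which the Landau symbols of the library
  do not apply.
\<close>

definition upper_order :: "(nat \<Rightarrow> enat) \<Rightarrow> (nat \<Rightarrow> real) \<Rightarrow> bool" where
  "upper_order f g \<longleftrightarrow>
     (\<exists>c>0. \<forall>\<^sub>F n in sequentially. ereal_of_enat (f n) \<le> ereal (c * g n))"

definition lower_order :: "(nat \<Rightarrow> enat) \<Rightarrow> (nat \<Rightarrow> real) \<Rightarrow> bool" where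
  "lower_order f g \<longleftrightarrow>
     (\<exists>c>0. \<forall>\<^sub>F n in sequentially. ereal (c * g n) \<le> ereal_of_enat (f n))"

definition complexity_O :: "(ugraph \<Rightarrow> bool) \<Rightarrow> nat poly \<Rightarrow> problem \<Rightarrow> (nat \<Rightarrow> real) \<Rightarrow> bool" where
  "complexity_O C q P g \<longleftrightarrow>
     (\<exists>A. solves C q P A \<and> upper_order (round_complexity C q P A) g)"

definition complexity_Omega :: "(ugraph \<Rightarrow> bool) \<Rightarrow> nat poly \<Rightarrow> problem \<Rightarrow> (nat \<Rightarrow> real) \<Rightarrow> bool" where
  "complexity_Omega C q P g \<longleftrightarrow>
     (\<forall>A. solves C q P A \<longrightarrow> lower_order (round_complexity C q P A) g)"

definition complexity_Theta :: "(ugraph \<Rightarrow> bool) \<Rightarrow> nat poly \<Rightarrow> problem \<Rightarrow> (nat \<Rightarrow> real) \<Rightarrow> bool" where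
  "complexity_Theta C q P g \<longleftrightarrow> complexity_O C q P g \<and> complexity_Omega C q P g"

end

(*
  Call a neighbor u of v steep if deg(v) >= 2 and deg(u) >= deg(v)^2. The problem asks each node
  to output 1 iff its input is 1 or some steep neighbor outputs 1. Along a chain of steep
  neighbors the degrees grow doubly exponentially, so chains have length at most log log n, and
  flooding along them for log log N rounds produces the labeling. Conversely a caterpillar
  whose spine nodes have degrees b^(4^i), i = 1, 2, ..., contains a steep chain of length
  Omega(log log n), and the output at its lower end depends on the input at its upper end.
*)
theory Submission
  imports Defs "HOL-Real_Asymp.Real_Asymp"
begin

section \<open>The problem\<close>

text \<open>Degree at least 2 makes squaring strictly increasing, so degrees grow strictly along
  steep steps and the output rule is never circular.\<close>

definition steep :: "ugraph \<Rightarrow> nat \<Rightarrow> nat \<Rightarrow> bool" where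
  "steep G v u \<longleftrightarrow> 2 \<le> deg G v \<and> u \<in> neighbors G v \<and> (deg G v)\<^sup>2 \<le> deg G u"

definition steep_pred :: local_pred where
  "steep_pred H c l \<longleftrightarrow>
     (snd (l c) = 1 \<longleftrightarrow> fst (l c) = 1 \<or> (\<exists>u. steep H c u \<and> snd (l u) = 1))"

text \<open>Radius 2: the degree of a neighbor of the center is visible only if the neighbor's own
  neighbors lie in the ball.\<close>

definition steep_problem :: problem where
  "steep_problem = \<lparr>in_labels = {0, 1}, out_labels = {0, 1}, radius = 2, lpred = steep_pred\<rparr>"

lemma steep_problem_simps [simp]:
  "in_labels steep_problem = {0, 1}" "out_labels steep_problem = {0, 1}"
  "radius steep_problem = 2" "lpred steep_problem = steep_pred"
  by (simp_all add: steep_problem_def)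

lemma neighbors_subset: "pair_graph G \<Longrightarrow> neighbors G v \<subseteq> pverts G"
  using pair_wf_digraph.in_arcsD2[of G]
  by (auto simp: neighbors_def pair_graph_def pair_digraph_def pair_fin_digraph_def)

lemma finite_pverts: "pair_graph G \<Longrightarrow> finite (pverts G)"
  by (simp add: pair_graph_def pair_digraph_def pair_fin_digraph_def pair_fin_digraph_axioms_def)

lemma deg_less_card:
  assumes G: "pair_graph G" and v: "v \<in> pverts G"
  shows "deg G v < card (pverts G)"
proof -
  have "v \<notin> neighbors G v"
    using pair_loopfree_digraph.pair_no_loops[of G "(v, v)"] G
    by (auto simp: neighbors_def pair_graph_def pair_digraph_def)
  then have "neighbors G v \<subset> pverts G"
    using neighbors_subset[OF G] v by auto
  then show ?thesis
    unfolding deg_def using finite_pverts[OF G] by (rule psubset_card_mono[rotated])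
qed

lemma iso_invariant_steep_pred: "iso_invariant steep_pred"
  unfolding iso_invariant_def
proof (intro allI impI, elim conjE)
  fix H H' :: ugraph and f c and l l' :: "nat \<Rightarrow> nat \<times> nat"
  assume H: "pair_graph H" and H': "pair_graph H'" and c: "c \<in> pverts H"
    and bij: "bij_betw f (pverts H) (pverts H')"
    and arcs: "\<forall>u\<in>pverts H. \<forall>w\<in>pverts H. (u, w) \<in> parcs H \<longleftrightarrow> (f u, f w) \<in> parcs H'"
    and l: "\<forall>u\<in>pverts H. l' (f u) = l u"
  have nb: "neighbors H' (f u) = f ` neighbors H u" if u: "u \<in> pverts H" for u
  proof
    show "f ` neighbors H u \<subseteq> neighbors H' (f u)"
      using arcs u neighbors_subset[OF H, of u] by (auto simp: neighbors_def)
    show "neighbors H' (f u) \<subseteq> f ` neighbors H u"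
    proof
      fix y assume y: "y \<in> neighbors H' (f u)"
      then have "y \<in> f ` pverts H"
        using neighbors_subset[OF H', of "f u"] bij by (auto simp: bij_betw_def)
      then obtain w where "w \<in> pverts H" "y = f w" by blast
      then show "y \<in> f ` neighbors H u" using arcs u y by (auto simp: neighbors_def)
    qed
  qed
  have dg: "deg H' (f u) = deg H u" if u: "u \<in> pverts H" for u
    unfolding deg_def nb[OF u]
    by (rule card_image) (meson bij bij_betw_def inj_on_subset neighbors_subset[OF H])
  \<comment> \<open>The bijection controls only nodes of \<open>H\<close>, so both quantifiers are
    first confined to neighbors.\<close>
  have "(\<exists>u. steep H c u \<and> snd (l u) = 1) \<longleftrightarrow> (\<exists>u\<in>neighbors H c. steep H c u \<and> snd (l u) = 1)"
    by (auto simp: steep_def)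
  also have "\<dots> \<longleftrightarrow> (\<exists>u\<in>neighbors H c. steep H' (f c) (f u) \<and> snd (l' (f u)) = 1)"
    using neighbors_subset[OF H, of c] by (intro bex_cong) (auto simp: steep_def dg c nb l subset_iff)
  also have "\<dots> \<longleftrightarrow> (\<exists>u. steep H' (f c) u \<and> snd (l' u) = 1)"
    by (auto simp: steep_def nb c)
  finally show "steep_pred H c l = steep_pred H' (f c) l'"
    using l c by (simp add: steep_pred_def)
qed

lemma locally_checkable_steep_problem: "locally_checkable steep_problem"
  by (simp add: locally_checkable_def iso_invariant_steep_pred)

section \<open>Balls of radius 2\<close>

lemma ball_nodes_1:
  assumes G: "pair_graph G" and v: "v \<in> pverts G"
  shows "insert v (neighbors G v) \<subseteq> ball_nodes G (Suc r) v"
proof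
  interpret pair_graph G by (fact G)
  fix u assume "u \<in> insert v (neighbors G v)"
  then consider "u = v" | "(v, u) \<in> parcs G" by (auto simp: neighbors_def)
  then show "u \<in> ball_nodes G (Suc r) v"
  proof cases
    case 1
    have "awalk v [] v" using v by (simp add: awalk_Nil_iff)
    then show ?thesis unfolding ball_nodes_def using 1 by force
  next
    case 2
    then have "awalk v [(v, u)] u" using v by (simp add: awalk_def)
    then show ?thesis unfolding ball_nodes_def by force
  qed
qed

lemma ball_nodes_2:
  assumes G: "pair_graph G" and v: "v \<in> pverts G" and u: "u \<in> neighbors G v"
  shows "neighbors G u \<subseteq> ball_nodes G 2 v"
proof
  interpret pair_graph G by (fact G)
  fix w assume "w \<in> neighbors G u"
  then have "awalk v [(v, u), (u, w)] w"
    using v u by (auto simp: awalk_def neighbors_def)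
  then show "w \<in> ball_nodes G 2 v" unfolding ball_nodes_def by force
qed

lemma neighbors_ball_graph:
  "neighbors (ball_graph G r v) u = (if u \<in> ball_nodes G r v then neighbors G u \<inter> ball_nodes G r v else {})"
  by (auto simp: neighbors_def ball_graph_def)

text \<open>Everything that counts towards the degrees of \<open>v\<close> and of its neighbors is
  within distance 2, so cutting down to the ball changes none of these degrees.\<close>

lemma steep_ball_graph:
  assumes G: "pair_graph G" and v: "v \<in> pverts G"
  shows "steep (ball_graph G 2 v) v u \<longleftrightarrow> steep G v u"
proof -
  have *: "insert v (neighbors G v) \<subseteq> ball_nodes G 2 v"
    using ball_nodes_1[OF G v, of 1] by (simp add: numeral_2_eq_2)
  have nv: "neighbors (ball_graph G 2 v) v = neighbors G v"
    using * by (auto simp: neighbors_ball_graph)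
  moreover have "neighbors (ball_graph G 2 v) u = neighbors G u" if "u \<in> neighbors G v"
    using * that ball_nodes_2[OF G v that] by (auto simp: neighbors_ball_graph)
  ultimately show ?thesis by (auto simp: steep_def deg_def)
qed

lemma valid_labeling_steep:
  assumes "pair_graph G"
  shows "valid_labeling steep_problem G lin lout \<longleftrightarrow>
    (\<forall>v\<in>pverts G. lout v \<in> {0, 1} \<and>
       (lout v = 1 \<longleftrightarrow> lin v = 1 \<or> (\<exists>u. steep G v u \<and> lout u = 1)))"
  using assms by (auto simp: valid_labeling_def steep_pred_def steep_ball_graph)

section \<open>The upper bound\<close>

text \<open>A message has one bit more than the sender's degree, hence the strict inequality. All
  earlier messages are searched, so an active node stays active.\<close>

definition active :: "knowledge \<Rightarrow> bool" where
  "active k \<longleftrightarrow> own_input k = 1 \<or>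
     2 \<le> own_deg k \<and>
     (\<exists>ms\<in>set (received k). \<exists>m\<in>set ms. hd m \<and> (own_deg k)\<^sup>2 < length m)"

text \<open>About log log \<open>N\<close>: a steep chain starting at degree 2 or more reaches
  degree at least \<open>2 ^ 2 ^ t\<close> after \<open>t\<close> steps, which is impossible once
  this exceeds \<open>N\<close>.\<close>

definition wait_time :: "nat \<Rightarrow> nat" where
  "wait_time N = (LEAST t. N < 2 ^ 2 ^ t)"

text \<open>A message consists of the current state, followed by the degree of the sender in unary.\<close>

definition steep_algorithm :: algorithm where
  "steep_algorithm =
     \<lparr>send = (\<lambda>k i. active k # replicate (own_deg k) True),
      decide = (\<lambda>k. if wait_time (known_bound k) \<le> length (received k)
                    then Some (if active k then 1 else 0) else None)\<rparr>"

lemma networksD: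
  assumes "I \<in> networks C q P"
  shows "pair_graph (topology I)"
    "card (pverts (topology I)) \<le> id_bound I"
    "id_bound I \<le> poly q (card (pverts (topology I)))"
    "v \<in> pverts (topology I) \<Longrightarrow>
       bij_betw (port I v) {..<deg (topology I) v} (neighbors (topology I) v)"
  using assms
  by (auto simp: networks_def Let_def connected_graph_def)

lemma knowledge_after_simps [simp]:
  "known_bound (knowledge_after A I t v) = id_bound I"
  "own_deg (knowledge_after A I t v) = deg (topology I) v"
  "own_input (knowledge_after A I t v) = input I v"
  "length (received (knowledge_after A I t v)) = t"
  by (induction t) (simp_all add: initial_knowledge_def)

definition active_after :: "network \<Rightarrow> nat \<Rightarrow> nat \<Rightarrow> bool" where
  "active_after I t v \<longleftrightarrow> active (knowledge_after steep_algorithm I t v)"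

lemma active_after_0: "active_after I 0 v \<longleftrightarrow> input I v = 1"
  by (simp add: active_after_def active_def initial_knowledge_def)

text \<open>Translates messages into a flooding rule. Only the set of messages matters, so port
  numbers drop out; the input and the old messages account for the first disjunct.\<close>

lemma active_after_Suc:
  assumes I: "I \<in> networks C q P" and v: "v \<in> pverts (topology I)"
  shows "active_after I (Suc t) v \<longleftrightarrow>
    active_after I t v \<or> (\<exists>u. steep (topology I) v u \<and> active_after I t u)"
proof -
  let ?G = "topology I"
  have nb: "neighbors ?G v = port I v ` {..<deg ?G v}"
    using networksD(4)[OF I v] by (simp add: bij_betw_def)
  have "(\<exists>m\<in>set (map (\<lambda>i. let u = port I v i in send steep_algorithm
            (knowledge_after steep_algorithm I t u) (port_to I u v)) [0..<deg ?G v]).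
            hd m \<and> (deg ?G v)\<^sup>2 < length m) \<longleftrightarrow>
        (\<exists>u\<in>neighbors ?G v. active_after I t u \<and> (deg ?G v)\<^sup>2 \<le> deg ?G u)"
    unfolding nb
    by (auto simp: Let_def steep_algorithm_def active_after_def less_Suc_eq_le)
  then show ?thesis
    unfolding active_after_def active_def[of "knowledge_after steep_algorithm I (Suc t) v"]
      active_def[of "knowledge_after steep_algorithm I t v"]
    by (auto simp: steep_def active_after_def)
qed

section \<open>Stabilization and correctness of the flooding\<close>

text \<open>A change at \<open>v\<close> needs a change at a steep neighbor one round earlier. That
  neighbor has at least the squared degree, so the hypothesis passes to it with \<open>t\<close>
  lowered by one.\<close>

lemma active_after_stable:
  assumes I: "I \<in> networks C q P" and "v \<in> pverts (topology I)"
    and "id_bound I < deg (topology I) v ^ 2 ^ t"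
  shows "active_after I (Suc t) v \<longleftrightarrow> active_after I t v"
  using assms(2,3)
proof (induction t arbitrary: v)
  \<comment> \<open>Vacuous: degrees are below the number of nodes, hence below
    \<open>id_bound I\<close>.\<close>
  case 0
  then show ?case
    using deg_less_card[OF networksD(1)[OF I] 0(1)] networksD(2)[OF I] by simp
next
  case (Suc t)
  let ?G = "topology I"
  have "active_after I (Suc t) u \<longleftrightarrow> active_after I t u" if u: "steep ?G v u" for u
  proof (rule Suc.IH)
    show "u \<in> pverts ?G"
      using u neighbors_subset[OF networksD(1)[OF I]] by (auto simp: steep_def)
    have "deg ?G v ^ 2 ^ Suc t = ((deg ?G v)\<^sup>2) ^ 2 ^ t" by (simp flip: power_mult)
    also have "\<dots> \<le> deg ?G u ^ 2 ^ t" using u by (intro power_mono) (auto simp: steep_def)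
    finally show "id_bound I < deg ?G u ^ 2 ^ t" using Suc.prems(2) by simp
  qed
  then show ?case using active_after_Suc[OF I Suc.prems(1)] by blast
qed

lemma less_wait_time: "N < 2 ^ 2 ^ wait_time N"
proof -
  have "N < 2 ^ 2 ^ N" by (meson less_exp less_trans)
  then show ?thesis unfolding wait_time_def by (rule LeastI)
qed

lemma le_wait_time: "t < wait_time N \<Longrightarrow> 2 ^ 2 ^ t \<le> N"
  unfolding wait_time_def using not_less_Least by (metis not_less)

lemma active_after_wait_time:
  assumes I: "I \<in> networks C q P" and v: "v \<in> pverts (topology I)"
  shows "active_after I (Suc (wait_time (id_bound I))) v \<longleftrightarrow>
    active_after I (wait_time (id_bound I)) v"
proof (cases "2 \<le> deg (topology I) v")
  case True
  have "id_bound I < 2 ^ 2 ^ wait_time (id_bound I)" by (rule less_wait_time)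
  also have "\<dots> \<le> deg (topology I) v ^ 2 ^ wait_time (id_bound I)"
    using True by (intro power_mono) auto
  finally show ?thesis by (rule active_after_stable[OF I v])
next
  case False
  then show ?thesis using active_after_Suc[OF I v] by (simp add: steep_def)
qed

lemma has_output_steep_algorithm:
  "has_output steep_algorithm I v t \<longleftrightarrow> wait_time (id_bound I) \<le> t"
  by (simp add: has_output_def steep_algorithm_def)

lemma output_label_steep_algorithm:
  "output_label steep_algorithm I v = (if active_after I (wait_time (id_bound I)) v then 1 else 0)"
proof -
  have "(LEAST t. has_output steep_algorithm I v t) = wait_time (id_bound I)"
    by (auto simp: has_output_steep_algorithm intro: Least_equality)
  then show ?thesis
    unfolding output_label_def by (simp add: active_after_def) (simp add: steep_algorithm_def)
qed

lemma solves_steep_algorithm: "solves C q steep_problem steep_algorithm"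
  unfolding solves_def
proof (intro ballI conjI)
  fix I v assume "I \<in> networks C q steep_problem"
  show "\<exists>t. has_output steep_algorithm I v t" by (auto simp: has_output_steep_algorithm)
next
  fix I assume I: "I \<in> networks C q steep_problem"
  let ?T = "wait_time (id_bound I)"
  have mono: "active_after I 0 v \<Longrightarrow> active_after I t v" if "v \<in> pverts (topology I)" for v t
    by (induction t) (auto simp: active_after_Suc[OF I that])
  \<comment> \<open>Stability alone does not give the output rule: an active node must also have a
    cause. A neighbor that caused activity earlier is still active now.\<close>
  have only: "active_after I t v \<Longrightarrow> input I v = 1 \<or> (\<exists>u. steep (topology I) v u \<and> active_after I t u)"
    if "v \<in> pverts (topology I)" for v t
    using that
  proof (induction t arbitrary: v)
    case 0
    then show ?case by (simp add: active_after_0)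
  next
    case (Suc t)
    have "active_after I (Suc t) u" if "steep (topology I) v u" "active_after I t u" for u
    proof -
      have "u \<in> pverts (topology I)"
        using that neighbors_subset[OF networksD(1)[OF I]] by (auto simp: steep_def)
      then show ?thesis using that active_after_Suc[OF I] by blast
    qed
    then show ?case using Suc active_after_Suc[OF I Suc.prems(2)] by blast
  qed
  have "active_after I ?T v \<longleftrightarrow>
      input I v = 1 \<or> (\<exists>u. steep (topology I) v u \<and> active_after I ?T u)"
    if v: "v \<in> pverts (topology I)" for v
    using active_after_wait_time[OF I v] active_after_Suc[OF I v] mono[OF v] only[OF v]
    by (metis active_after_0)
  then show "valid_labeling steep_problem (topology I) (input I) (output_label steep_algorithm I)"
    by (auto simp: valid_labeling_steep[OF networksD(1)[OF I]] output_label_steep_algorithm)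
qed

section \<open>Estimating the waiting time\<close>

text \<open>\<open>poly q 1\<close> is the sum of the coefficients and is absorbed by
  \<open>n ^ poly q 1\<close>. The wasteful exponent only adds a constant after two
  logarithms.\<close>

lemma poly_le_power:
  fixes q :: "nat poly"
  assumes n: "2 \<le> n"
  shows "poly q n \<le> n ^ (poly q 1 + degree q)"
proof -
  have "poly q n = (\<Sum>i\<le>degree q. coeff q i * n ^ i)" by (simp add: poly_altdef)
  also have "\<dots> \<le> (\<Sum>i\<le>degree q. coeff q i * n ^ degree q)"
    using n by (intro sum_mono mult_left_mono power_increasing) auto
  also have "\<dots> = poly q 1 * n ^ degree q" by (simp add: poly_altdef sum_distrib_right)
  also have "poly q 1 \<le> n ^ poly q 1"
  proof -
    have "poly q 1 \<le> 2 ^ poly q 1" using less_exp[of "poly q 1"] by linarith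
    also have "\<dots> \<le> n ^ poly q 1" using n by (intro power_mono) auto
    finally show ?thesis .
  qed
  finally show ?thesis by (simp add: power_add)
qed

text \<open>By minimality, \<open>2 ^ 2 ^ t \<le> N\<close> holds one step before the waiting time;
  two logarithms turn the exponent \<open>e\<close> into an additive constant.\<close>

lemma wait_time_le:
  assumes n: "2 \<le> n" and N: "N \<le> n ^ e" and e: "1 \<le> e"
  shows "real (wait_time N) \<le> 1 + log 2 (real e) + log 2 (log 2 (real n))"
proof (cases "wait_time N")
  case 0
  have "1 \<le> log 2 (real n)" using n by simp
  then have "0 \<le> log 2 (log 2 (real n))" by simp
  then show ?thesis using 0 e by simp
next
  case (Suc t)
  have ln: "1 \<le> log 2 (real n)" using n by simp
  have "2 ^ 2 ^ t \<le> n ^ e" using le_wait_time[of t N] Suc N by simp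
  then have "real (2 ^ 2 ^ t) \<le> real (n ^ e)" by (rule of_nat_mono)
  then have "log 2 (2 ^ 2 ^ t) \<le> log 2 (real n ^ e)" using n by (subst log_le_cancel_iff) auto
  then have "2 ^ t \<le> real e * log 2 (real n)" using n by (simp add: log_nat_power)
  then have "log 2 (2 ^ t) \<le> log 2 (real e * log 2 (real n))"
    using e ln by (subst log_le_cancel_iff) auto
  then have "real t \<le> log 2 (real e) + log 2 (log 2 (real n))"
    using e ln by (simp add: log_mult log_nat_power)
  then show ?thesis using Suc by simp
qed

lemma complexity_O_steep_problem:
  "complexity_O C q steep_problem (\<lambda>n. log 2 (log 2 (real n)))"
proof -
  \<comment> \<open>\<open>Suc\<close> ensures \<open>1 \<le> e\<close>, so that
    \<open>log 2 (real e)\<close> is nonnegative.\<close>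
  define e where "e = Suc (poly q 1 + degree q)"
  \<comment> \<open>For large \<open>n\<close> the additive constant is absorbed by a second copy of
    log log \<open>n\<close>, whence the factor 2.\<close>
  have "eventually (\<lambda>n. 1 + log 2 (real e) \<le> log 2 (log 2 (real n))) sequentially"
    by real_asymp
  moreover have "eventually (\<lambda>n::nat. 2 \<le> n) sequentially" by (rule eventually_ge_at_top)
  ultimately have "eventually (\<lambda>n. ereal_of_enat (round_complexity C q steep_problem steep_algorithm n)
       \<le> ereal (2 * log 2 (log 2 (real n)))) sequentially"
  proof eventually_elim
    case (elim n)
    have "rounds steep_algorithm I \<le> enat (nat \<lfloor>2 * log 2 (log 2 (real n))\<rfloor>)"
      if I: "I \<in> networks C q steep_problem" and c: "card (pverts (topology I)) = n" for I
    proof -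
      have "id_bound I \<le> poly q n" using networksD(3)[OF I] c by simp
      also have "\<dots> \<le> n ^ (poly q 1 + degree q)" by (rule poly_le_power[OF elim(2)])
      also have "\<dots> \<le> n ^ e" using elim(2) by (intro power_increasing) (auto simp: e_def)
      finally have "id_bound I \<le> n ^ e" .
      then have "real (wait_time (id_bound I)) \<le> 2 * log 2 (log 2 (real n))"
        using wait_time_le[OF elim(2), of "id_bound I" e] elim(1) by (simp add: e_def)
      then have *: "wait_time (id_bound I) \<le> nat \<lfloor>2 * log 2 (log 2 (real n))\<rfloor>"
        by (simp add: le_nat_floor)
      show ?thesis unfolding rounds_def
        by (intro SUP_least INF_lower2[of "wait_time (id_bound I)"])
          (use * in \<open>auto simp: has_output_steep_algorithm\<close>)
    qed
    then have "round_complexity C q steep_problem steep_algorithm n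
        \<le> enat (nat \<lfloor>2 * log 2 (log 2 (real n))\<rfloor>)"
      unfolding round_complexity_def by (intro SUP_least) auto
    then have "ereal_of_enat (round_complexity C q steep_problem steep_algorithm n)
        \<le> ereal_of_enat (enat (nat \<lfloor>2 * log 2 (log 2 (real n))\<rfloor>))"
      by (simp only: ereal_of_enat_le_iff)
    also have "\<dots> \<le> ereal (2 * log 2 (log 2 (real n)))"
    proof -
      have "0 \<le> log 2 (real e)" by (simp add: e_def)
      then show ?thesis using elim(1) by simp
    qed
    finally show ?case .
  qed
  then show ?thesis
    unfolding complexity_O_def upper_order_def using solves_steep_algorithm
    by (intro exI[of _ steep_algorithm] conjI exI[of _ "2::real"]) auto
qed

section \<open>The lower bound\<close>

text \<open>The root is 0, and \<open>par 0\<close> is ignored. With parents smaller than children,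
  every nonempty prefix \<open>{..<n}\<close> carries a tree, so one function serves all
  sizes.\<close>

definition parent_tree :: "(nat \<Rightarrow> nat) \<Rightarrow> nat \<Rightarrow> ugraph" where
  "parent_tree par n = \<lparr>pverts = {..<n},
     parcs = {(u, v). u < n \<and> v < n \<and> (0 < u \<and> v = par u \<or> 0 < v \<and> u = par v)}\<rparr>"

lemma pverts_parent_tree [simp]: "pverts (parent_tree par n) = {..<n}"
  by (simp add: parent_tree_def)

lemma parcs_parent_tree:
  "(u, v) \<in> parcs (parent_tree par n) \<longleftrightarrow>
     u < n \<and> v < n \<and> (0 < u \<and> v = par u \<or> 0 < v \<and> u = par v)"
  by (simp add: parent_tree_def)

lemma pair_graph_parent_tree:
  assumes par: "\<And>j. 0 < j \<Longrightarrow> par j < j"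
  shows "pair_graph (parent_tree par n)"
proof
  let ?T = "parent_tree par n"
  have "parcs ?T \<subseteq> {..<n} \<times> {..<n}" by (auto simp: parcs_parent_tree)
  then show "finite (parcs ?T)" by (rule finite_subset) simp
  show "finite (pverts ?T)" by simp
  show "symmetric ?T"
    by (auto simp: symmetric_def parcs_parent_tree intro!: symI)
  fix e assume "e \<in> parcs ?T"
  then have "(fst e, snd e) \<in> parcs ?T" by simp
  then have "fst e < n" "snd e < n" "fst e < snd e \<or> snd e < fst e"
    unfolding parcs_parent_tree using par by metis+
  then show "fst e \<in> pverts ?T" "snd e \<in> pverts ?T" "fst e \<noteq> snd e" by auto
qed

text \<open>Parents strictly decrease, so every node reaches the root 0; symmetry reverses these
  walks.\<close>

lemma connected_parent_tree:
  assumes par: "\<And>j. 0 < j \<Longrightarrow> par j < j" and n: "0 < n"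
  shows "Digraph_Component.connected (with_proj (parent_tree par n))"
proof -
  let ?T = "parent_tree par n"
  interpret pair_graph ?T using par by (rule pair_graph_parent_tree)
  have root: "v \<rightarrow>\<^sup>*\<^bsub>?T\<^esub> 0" if "v < n" for v
    using that
  proof (induction v rule: less_induct)
    case (less v)
    show ?case
    proof (cases "v = 0")
      case True
      then show ?thesis using n by simp
    next
      case False
      then have "par v < v" using par by simp
      then have "(v, par v) \<in> parcs ?T" using False less.prems by (simp add: parcs_parent_tree)
      moreover have "par v \<rightarrow>\<^sup>*\<^bsub>?T\<^esub> 0" using less \<open>par v < v\<close> by simp
      ultimately show ?thesis by (rule adj_reachable_trans)
    qed
  qed
  show ?thesis unfolding Digraph_Component.connected_def
  proof
    show "verts (with_proj (mk_symmetric (with_proj ?T))) \<noteq> {}" using n by auto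
    fix u v assume "u \<in> verts (with_proj (mk_symmetric (with_proj ?T)))"
      "v \<in> verts (with_proj (mk_symmetric (with_proj ?T)))"
    then have "u < n" "v < n" by auto
    then have "u \<rightarrow>\<^sup>*\<^bsub>?T\<^esub> v"
      using root[of u] root[of v] symmetric_reachable' reachable_trans by blast
    then show "u \<rightarrow>\<^sup>*\<^bsub>with_proj (mk_symmetric (with_proj ?T))\<^esub> v"
      by (rule reachable_mk_symmetricI)
  qed
qed

lemma pcas_nth: "pcas u p v \<Longrightarrow> Suc i < length p \<Longrightarrow> fst (p ! Suc i) = snd (p ! i)"
proof (induction p arbitrary: u i)
  case (Cons e p)
  show ?case
  proof (cases i)
    case 0
    then show ?thesis using Cons.prems by (cases p) auto
  next
    case (Suc j)
    then show ?thesis using Cons.prems Cons.IH[of "snd e" j] by simp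
  qed
qed simp

lemma pcas_ends: "pcas u p v \<Longrightarrow> p \<noteq> [] \<Longrightarrow> fst (p ! 0) = u \<and> snd (p ! (length p - 1)) = v"
proof (induction p arbitrary: u)
  case (Cons e p)
  then show ?case by (cases p) auto
qed simp

text \<open>Both cycle neighbors of the largest node of a cycle would be its parent.\<close>

lemma acyclic_parent_tree:
  assumes par: "\<And>j. 0 < j \<Longrightarrow> par j < j"
    and p: "pre_digraph.cycle (with_proj (parent_tree par n)) p" and len: "3 \<le> length p"
  shows False
proof -
  let ?T = "parent_tree par n"
  let ?L = "length p"
  interpret pair_graph ?T using par by (rule pair_graph_parent_tree)
  obtain u where u: "awalk u p u" and d: "distinct (tl (pawalk_verts u p))" and ne: "p \<noteq> []"
    using p unfolding cycle_def by auto
  have cas: "pcas u p u" and arcs: "set p \<subseteq> parcs ?T" using u by (auto simp: awalk_def)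
  have d: "distinct (map snd p)"
    using d ne awalk_verts_conv'[OF cas] by simp
  define a where "a i = snd (p ! i)" for i
  have a_inj: "i = j" if "a i = a j" "i < ?L" "j < ?L" for i j
    using that d nth_eq_iff_index_eq[of "map snd p" i j] by (simp add: a_def)
  \<comment> \<open>Indices are cyclic: the wrap-around works because the walk ends where it
    starts.\<close>
  have step: "p ! (Suc i mod ?L) = (a i, a (Suc i mod ?L))" if "i < ?L" for i
  proof (cases "Suc i < ?L")
    case True
    then show ?thesis using pcas_nth[OF cas, of i] by (simp add: a_def prod_eq_iff)
  next
    case False
    then have i: "i = ?L - 1" using that by simp
    show ?thesis unfolding i using pcas_ends[OF cas ne] ne by (simp add: a_def prod_eq_iff)
  qed
  have down: "y = par x" if "(x, y) \<in> parcs ?T \<or> (y, x) \<in> parcs ?T" "y \<le> x" for x y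
    using that par[of x] par[of y] by (auto simp: parcs_parent_tree)
  obtain m where m: "m < ?L" and max: "\<And>i. i < ?L \<Longrightarrow> a i \<le> a m"
  proof -
    have "Max (a ` {..<?L}) \<in> a ` {..<?L}" using ne by (intro Max_in) auto
    then obtain m where "m < ?L" "a m = Max (a ` {..<?L})" by auto
    then show ?thesis by (intro that[of m]) auto
  qed
  define i where "i = (if m = 0 then ?L - 1 else m - 1)"
  define j where "j = Suc m mod ?L"
  have i: "i < ?L" "Suc i mod ?L = m" using m by (auto simp: i_def)
  have j: "j < ?L" using ne by (simp add: j_def)
  have "(a i, a m) \<in> parcs ?T" using step[OF i(1)] i(2) nth_mem[OF m] arcs by auto
  then have "a i = par (a m)" using max[OF i(1)] down by blast
  moreover have "(a m, a j) \<in> parcs ?T" using step[OF m] nth_mem[OF j] arcs unfolding j_def by auto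
  then have "a j = par (a m)" using max[OF j] down by blast
  ultimately have "i = j" using a_inj i(1) j by simp
  \<comment> \<open>\<open>i\<close> and \<open>j\<close> are the cyclic predecessor and successor
    of \<open>m\<close>, which coincide only for length at most 2.\<close>
  then show False using len m by (auto simp: i_def j_def mod_Suc split: if_splits)
qed

lemma tree_graph_parent_tree:
  assumes "\<And>j. 0 < j \<Longrightarrow> par j < j" "0 < n"
  shows "tree_graph (parent_tree par n)"
  using assms acyclic_parent_tree[of par n] pair_graph_parent_tree[of par n]
    connected_parent_tree[of par n]
  unfolding tree_graph_def connected_graph_def by blast

section \<open>Indistinguishable inputs\<close>

text \<open>\<open>f\<close> acts as a lower bound on the distance to the changed inputs: these sit
  where \<open>f v = 0\<close>, and \<open>f\<close> drops by at most 1 along an edge, so news needs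
  at least \<open>f v\<close> rounds to reach \<open>v\<close>.\<close>

lemma knowledge_after_cong:
  assumes I: "I \<in> networks C q P" and I': "I' = I\<lparr>input := inp\<rparr>"
    and inp: "\<And>v. v \<in> pverts (topology I) \<Longrightarrow> 0 < f v \<Longrightarrow> inp v = input I v"
    and lip: "\<And>u v. u \<in> neighbors (topology I) v \<Longrightarrow> f v \<le> Suc (f u)"
    and "v \<in> pverts (topology I)" "t < f v"
  shows "knowledge_after A I' t v = knowledge_after A I t v"
  using assms(5,6)
proof (induction t arbitrary: v)
  case 0
  then show ?case using inp by (simp add: initial_knowledge_def I')
next
  case (Suc t)
  have "knowledge_after A I' t u = knowledge_after A I t u" if "u \<in> neighbors (topology I) v" for u
    using that Suc.IH[of u] lip[OF that] Suc.prems(2) neighbors_subset[OF networksD(1)[OF I], of v]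
    by auto
  moreover have "port I v i \<in> neighbors (topology I) v" if "i < deg (topology I) v" for i
    using networksD(4)[OF I Suc.prems(1)] that by (auto simp: bij_betw_def)
  moreover have "port_to I' = port_to I" by (simp add: port_to_def I' fun_eq_iff)
  ultimately show ?case using Suc.IH[of v] Suc.prems by (simp add: Let_def I')
qed

text \<open>A decision in \<open>I\<close> before time \<open>k\<close> would be made in
  \<open>I'\<close> at the same time, from the same knowledge and with the same label.\<close>

lemma rounds_ge_if_outputs_differ:
  assumes v: "v \<in> pverts (topology I)"
    and eq: "\<And>t. t < k \<Longrightarrow> knowledge_after A I' t v = knowledge_after A I t v"
    and diff: "output_label A I' v \<noteq> output_label A I v"
  shows "enat k \<le> rounds A I"
proof -
  have "k \<le> t" if t: "has_output A I v t" for t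
  proof (rule ccontr)
    assume "\<not> k \<le> t"
    have out: "has_output A I' v s \<longleftrightarrow> has_output A I v s" if "s < k" for s
      using eq[OF that] by (simp add: has_output_def)
    define s where "s = (LEAST t. has_output A I v t)"
    have s: "has_output A I v s" "s \<le> t" unfolding s_def using t by (auto intro: LeastI Least_le)
    \<comment> \<open>The label is fixed by the first decision, so the first decision times must
      agree too. From \<open>k\<close> on the runs may differ, but those times are later than
      \<open>s\<close>.\<close>
    have "(LEAST t. has_output A I' v t) = s"
    proof (rule Least_equality)
      show "has_output A I' v s" using out s \<open>\<not> k \<le> t\<close> by simp
      fix r assume "has_output A I' v r"
      then show "s \<le> r" using out[of r] s \<open>\<not> k \<le> t\<close> Least_le[of "has_output A I v" r]
        unfolding s_def by (cases "r < k") auto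
    qed
    then have "output_label A I' v = output_label A I v"
      using eq[of s] s \<open>\<not> k \<le> t\<close> by (simp add: output_label_def flip: s_def)
    then show False using diff by simp
  qed
  then have "enat k \<le> (INF t\<in>{t. has_output A I v t}. enat t)"
    by (intro INF_greatest) auto
  also have "\<dots> \<le> rounds A I" unfolding rounds_def using v by (intro SUP_upper) auto
  finally show ?thesis .
qed

section \<open>The caterpillar\<close>

text \<open>
  The spine is the path \<open>0, ..., k\<close>; a node \<open>j > k\<close> is a leaf attached to the spine node \<open>i\<close> with
  \<open>b ^ 4 ^ i \<le> j < b ^ 4 ^ (i + 1)\<close>, so that the degree of \<open>i\<close> is about \<open>b ^ 4 ^ (i + 1)\<close>, where
  \<open>b = k + 2\<close>.
\<close>

definition spine_parent :: "nat \<Rightarrow> nat \<Rightarrow> nat" where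
  "spine_parent k j = (if j \<le> k then j - 1 else card {i\<in>{1..k}. (k + 2) ^ 4 ^ i \<le> j})"

lemma spine_parent_le: "spine_parent k j \<le> k"
proof -
  have "card {i\<in>{1..k}. (k + 2) ^ 4 ^ i \<le> j} \<le> card {1..k}" by (intro card_mono) auto
  then show ?thesis by (auto simp: spine_parent_def)
qed

lemma spine_parent_less: "0 < j \<Longrightarrow> spine_parent k j < j"
  using spine_parent_le[of k j] by (cases "j \<le> k") (auto simp: spine_parent_def)

lemma tower_mono: "i \<le> j \<Longrightarrow> (k + 2 :: nat) ^ 4 ^ i \<le> (k + 2) ^ 4 ^ j"
  by (intro power_increasing) auto

lemma tower_ge: "k + 2 \<le> (k + 2 :: nat) ^ 4 ^ i"
  using self_le_power[of "k + 2" "4 ^ i"] by simp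

text \<open>Thresholds increase with their index, so those up to \<open>j\<close> form an initial
  segment, and counting them gives the index of the last.\<close>

lemma spine_parent_eq:
  assumes "i \<le> k" "(k + 2) ^ 4 ^ i \<le> j" "j < (k + 2) ^ 4 ^ Suc i"
  shows "spine_parent k j = i"
proof -
  have "{i'\<in>{1..k}. (k + 2) ^ 4 ^ i' \<le> j} = {1..i}"
  proof (intro equalityI subsetI)
    fix i' assume i': "i' \<in> {i'\<in>{1..k}. (k + 2) ^ 4 ^ i' \<le> j}"
    have "i' \<le> i"
    proof (rule ccontr)
      assume "\<not> i' \<le> i"
      then have "(k + 2) ^ 4 ^ Suc i \<le> (k + 2) ^ 4 ^ i'" by (intro tower_mono) simp
      also have "\<dots> \<le> j" using i' by simp
      finally show False using assms(3) by linarith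
    qed
    then show "i' \<in> {1..i}" using i' by simp
  next
    fix i' assume i': "i' \<in> {1..i}"
    then have "(k + 2) ^ 4 ^ i' \<le> (k + 2) ^ 4 ^ i" by (intro tower_mono) simp
    also have "\<dots> \<le> j" by (rule assms(2))
    finally show "i' \<in> {i'\<in>{1..k}. (k + 2) ^ 4 ^ i' \<le> j}" using i' assms(1) by simp
  qed
  moreover have "k < j" using tower_ge[of k i] assms by simp
  ultimately show ?thesis by (simp add: spine_parent_def)
qed

text \<open>Otherwise one more threshold would be counted. The last spine node is excluded, as it
  takes all remaining leaves.\<close>

lemma less_tower_spine_parent:
  assumes "k < j" "spine_parent k j < k"
  shows "j < (k + 2) ^ 4 ^ Suc (spine_parent k j)"
proof (rule ccontr)
  let ?i = "spine_parent k j"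
  assume *: "\<not> j < (k + 2) ^ 4 ^ Suc ?i"
  have "{1..Suc ?i} \<subseteq> {i\<in>{1..k}. (k + 2) ^ 4 ^ i \<le> j}"
  proof
    fix i assume i: "i \<in> {1..Suc ?i}"
    then have "(k + 2) ^ 4 ^ i \<le> (k + 2) ^ 4 ^ Suc ?i" by (intro tower_mono) simp
    also have "\<dots> \<le> j" using * by linarith
    finally show "i \<in> {i\<in>{1..k}. (k + 2) ^ 4 ^ i \<le> j}"
      using i assms(2) by simp
  qed
  then have "card {1..Suc ?i} \<le> card {i\<in>{1..k}. (k + 2) ^ 4 ^ i \<le> j}" by (intro card_mono) auto
  then show False using assms(1) by (simp add: spine_parent_def)
qed

abbreviation spine_tree :: "nat \<Rightarrow> nat \<Rightarrow> ugraph" where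
  "spine_tree k n \<equiv> parent_tree (spine_parent k) n"

lemma deg_spine_tree_le:
  assumes "i < k"
  shows "deg (spine_tree k n) i \<le> (k + 2) ^ 4 ^ Suc i"
proof -
  have "neighbors (spine_tree k n) i \<subseteq> {..<(k + 2) ^ 4 ^ Suc i}"
  proof
    fix v assume "v \<in> neighbors (spine_tree k n) i"
    then have "v \<le> k \<or> k < v \<and> spine_parent k v = i"
      using spine_parent_le[of k i] by (auto simp: neighbors_def parcs_parent_tree)
    then show "v \<in> {..<(k + 2) ^ 4 ^ Suc i}"
      using tower_ge[of k "Suc i"] less_tower_spine_parent[of k v] assms by auto
  qed
  then have "card (neighbors (spine_tree k n) i) \<le> card {..<(k + 2) ^ 4 ^ Suc i}"
    by (intro card_mono) auto
  then show ?thesis by (simp add: deg_def)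
qed

text \<open>The square is what steepness asks for: it matches the squared upper bound on the degree
  of spine node \<open>i - 1\<close>.\<close>

lemma deg_spine_tree_ge:
  assumes i: "i \<le> k" and n: "(k + 2) ^ 4 ^ Suc k \<le> n"
  shows "((k + 2) ^ 4 ^ i)\<^sup>2 \<le> deg (spine_tree k n) i"
proof -
  let ?x = "(k + 2) ^ 4 ^ i"
  let ?y = "(k + 2) ^ 4 ^ Suc i"
  have "v \<in> neighbors (spine_tree k n) i" if "?x \<le> v" "v < ?y" for v
  proof -
    have "v < n" using that(2) tower_mono[of "Suc i" "Suc k" k] i n by linarith
    moreover have "k < v" using that tower_ge[of k i] by linarith
    ultimately show ?thesis
      using i spine_parent_eq[OF i that] by (simp add: neighbors_def parcs_parent_tree)
  qed
  then have "card {?x..<?y} \<le> deg (spine_tree k n) i"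
    unfolding deg_def using finite_subset[OF neighbors_subset, OF pair_graph_parent_tree]
    by (intro card_mono) (auto simp: spine_parent_less)
  \<comment> \<open>\<open>?y\<close> is the fourth power of \<open>?x\<close>, so the interval from
    \<open>?x\<close> to \<open>?y\<close> still has at least \<open>?x\<^sup>2\<close>
    elements.\<close>
  moreover have "?x\<^sup>2 + ?x \<le> ?y"
  proof -
    have y: "?y = ?x\<^sup>2 * ?x\<^sup>2" by (simp flip: power_mult power_add)
    have x: "2 \<le> ?x" using tower_ge[of k i] by linarith
    have "?x\<^sup>2 + ?x \<le> ?x\<^sup>2 * 2" using self_le_power[of ?x 2] x by simp
    also have "\<dots> \<le> ?x\<^sup>2 * ?x\<^sup>2"
      using x self_le_power[of ?x 2] by (intro mult_left_mono) linarith+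
    finally show ?thesis using y by simp
  qed
  ultimately show ?thesis by simp
qed

lemma steep_spine_tree:
  assumes i: "i < k" and n: "(k + 2) ^ 4 ^ Suc k \<le> n"
  shows "steep (spine_tree k n) i (Suc i)"
proof -
  let ?T = "spine_tree k n"
  have "2 \<le> ((k + 2) ^ 4 ^ i)\<^sup>2"
    using tower_ge[of k i] self_le_power[of "(k + 2) ^ 4 ^ i" 2] by simp
  then have "2 \<le> deg ?T i" using deg_spine_tree_ge[of i k n] i n by linarith
  \<comment> \<open>The two degree bounds meet at
    \<open>((k + 2) ^ 4 ^ Suc i)\<^sup>2\<close>.\<close>
  moreover have "(deg ?T i)\<^sup>2 \<le> deg ?T (Suc i)"
    using power_mono[OF deg_spine_tree_le[OF i], of n 2] deg_spine_tree_ge[of "Suc i" k n] i n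
    by linarith
  moreover have "Suc i \<in> neighbors ?T i"
    using i n tower_ge[of k "Suc k"] by (auto simp: neighbors_def parcs_parent_tree spine_parent_def)
  ultimately show ?thesis by (simp add: steep_def)
qed

section \<open>Forced outputs and the lower bound on trees\<close>

text \<open>Without input 1, an output 1 needs a steep neighbor with output 1, which has larger
  degree. A node of largest degree among those with output 1 has none.\<close>

lemma valid_labeling_steep_zero:
  assumes G: "pair_graph G" and val: "valid_labeling steep_problem G (\<lambda>_. 0) lout"
    and v: "v \<in> pverts G"
  shows "lout v = 0"
proof (rule ccontr)
  assume "lout v \<noteq> 0"
  let ?S = "{v\<in>pverts G. lout v = 1}"
  have rule: "lout w \<in> {0, 1} \<and> (lout w = 1 \<longleftrightarrow> (\<exists>u. steep G w u \<and> lout u = 1))"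
    if "w \<in> pverts G" for w
    using val that unfolding valid_labeling_steep[OF G] by auto
  have "v \<in> ?S" using rule[OF v] \<open>lout v \<noteq> 0\<close> v by auto
  then obtain w where w: "w \<in> ?S" and max: "\<And>u. u \<in> ?S \<Longrightarrow> deg G u \<le> deg G w"
    using ex_has_greatest_nat[of "\<lambda>v. v \<in> ?S" v "deg G" "card (pverts G)"] deg_less_card[OF G]
    by (metis (mono_tags, lifting) less_or_eq_imp_le mem_Collect_eq)
  then obtain u where u: "steep G w u" "lout u = 1" using rule[of w] by auto
  then have "u \<in> ?S" using neighbors_subset[OF G] by (auto simp: steep_def)
  then have "deg G u \<le> deg G w" by (rule max)
  then have "(deg G w)\<^sup>2 \<le> deg G w" "2 \<le> deg G w" using u by (auto simp: steep_def)
  then show False by (simp add: power2_eq_square)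
qed

text \<open>The zero input is compared with a single 1 at spine node \<open>k\<close>. Every solver
  must answer 0 and 1, respectively, at node 0, which is \<open>k\<close> edges away from the
  change.\<close>

lemma round_complexity_steep_ge:
  assumes q: "admissible_poly q" and A: "solves tree_graph q steep_problem A"
    and n: "(k + 2) ^ 4 ^ Suc k \<le> n"
  shows "enat k \<le> round_complexity tree_graph q steep_problem A n"
proof -
  let ?T = "spine_tree k n"
  have kn: "k + 2 \<le> n" using tower_ge[of k "Suc k"] n by linarith
  have tree: "tree_graph ?T" using kn by (intro tree_graph_parent_tree spine_parent_less) auto
  then have conn: "connected_graph ?T" and G: "pair_graph ?T"
    by (auto simp: tree_graph_def connected_graph_def)
  have "\<exists>h. bij_betw h {..<deg ?T v} (neighbors ?T v)" for v
    using ex_bij_betw_nat_finite[of "neighbors ?T v"] finite_subset[OF neighbors_subset[OF G]]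
    by (simp add: deg_def atLeast0LessThan)
  then obtain h where h: "\<And>v. bij_betw (h v) {..<deg ?T v} (neighbors ?T v)" by metis
  \<comment> \<open>Names serve as identifiers and \<open>n\<close> as their bound, which every
    admissible \<open>q\<close> permits.\<close>
  define I where "I inp = \<lparr>topology = ?T, port = h, ident = id, id_bound = n, input = inp\<rparr>"
    for inp :: "nat \<Rightarrow> nat"
  have sel [simp]: "topology (I inp) = ?T" "input (I inp) = inp" for inp by (simp_all add: I_def)
  have net: "I inp \<in> networks tree_graph q steep_problem" if "\<And>v. inp v \<in> {0, 1}" for inp
  proof -
    have "inp ` {..<n} \<subseteq> {0, 1}" using that by (rule image_subsetI)
    then show ?thesis
      using conn tree h q kn by (auto simp: networks_def I_def admissible_poly_def simp del: insert_subset)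
  qed
  let ?in0 = "\<lambda>v. 0" and ?in1 = "\<lambda>v. if v = k then 1 else 0"
  have net0: "I ?in0 \<in> networks tree_graph q steep_problem"
    and net1: "I ?in1 \<in> networks tree_graph q steep_problem"
    by (rule net, simp)+
  have "valid_labeling steep_problem ?T ?in0 (output_label A (I ?in0))"
    using A net0 unfolding solves_def by fastforce
  from valid_labeling_steep_zero[OF G this] have out0: "output_label A (I ?in0) 0 = 0" using kn by simp
  have "valid_labeling steep_problem ?T ?in1 (output_label A (I ?in1))"
    using A net1 unfolding solves_def by fastforce
  then have rule: "output_label A (I ?in1) v = 1 \<longleftrightarrow>
      v = k \<or> (\<exists>u. steep ?T v u \<and> output_label A (I ?in1) u = 1)" if "v < n" for v
    using that unfolding valid_labeling_steep[OF G] by auto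
  \<comment> \<open>The 1 is forced down the steep chain, starting at its upper end
    \<open>k\<close>.\<close>
  have "output_label A (I ?in1) (k - i) = 1" if "i \<le> k" for i
    using that
  proof (induction i)
    case 0
    then show ?case using rule[of k] kn by simp
  next
    case (Suc i)
    then have "steep ?T (k - Suc i) (k - i)"
      using steep_spine_tree[of "k - Suc i" k n] n by (simp add: Suc_diff_Suc)
    then show ?case using rule[of "k - Suc i"] Suc kn by auto
  qed
  from this[of k] have out1: "output_label A (I ?in1) 0 = 1" by simp
  \<comment> \<open>\<open>f\<close> is the distance to spine node \<open>k\<close>, a leaf being
    one farther than its parent; \<open>f 0 = k\<close>.\<close>
  define f where "f v = (if v \<le> k then k - v else Suc (k - spine_parent k v))" for v
  have f_par: "f v \<le> Suc (f (spine_parent k v)) \<and> f (spine_parent k v) \<le> Suc (f v)" if "0 < v" for v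
  proof (cases "v \<le> k")
    case True
    then have "spine_parent k v = v - 1" by (simp add: spine_parent_def)
    then show ?thesis using True that by (auto simp: f_def)
  next
    case False
    then show ?thesis using spine_parent_le[of k v] by (simp add: f_def)
  qed
  have "enat k \<le> rounds A (I ?in0)"
  proof (rule rounds_ge_if_outputs_differ)
    show "0 \<in> pverts (topology (I ?in0))" using kn by simp
    show "output_label A (I ?in1) 0 \<noteq> output_label A (I ?in0) 0" using out0 out1 by simp
    fix t assume t: "t < k"
    show "knowledge_after A (I ?in1) t 0 = knowledge_after A (I ?in0) t 0"
    proof (rule knowledge_after_cong[OF net0, where f = f and inp = ?in1])
      show "I ?in1 = I ?in0\<lparr>input := ?in1\<rparr>" by (simp add: I_def)
      show "?in1 v = input (I ?in0) v" if "0 < f v" for v using that by (auto simp: f_def)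
      show "f v \<le> Suc (f u)" if "u \<in> neighbors (topology (I ?in0)) v" for u v
        using that f_par[of u] f_par[of v] by (auto simp: neighbors_def parcs_parent_tree)
      show "0 \<in> pverts (topology (I ?in0))" "t < f 0" using kn t by (auto simp: f_def)
    qed
  qed
  also have "\<dots> \<le> round_complexity tree_graph q steep_problem A n"
    unfolding round_complexity_def using net0 by (intro SUP_upper) auto
  finally show ?thesis .
qed

text \<open>Bounding the base by \<open>2 ^ 2 ^ Suc k\<close> gives a power of 2 with exponent
  \<open>2 ^ Suc k * 4 ^ Suc k\<close>, which is the source of the factor 3.\<close>

lemma tower_le:
  assumes n: "2 \<le> n" and s: "real (3 * Suc k) \<le> log 2 (log 2 (real n))"
  shows "(k + 2) ^ 4 ^ Suc k \<le> n"
proof -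
  have "1 \<le> log 2 (real n)" using n by simp
  then have "2 powr real (3 * Suc k) \<le> log 2 (real n)" using s by (subst (asm) le_log_iff) auto
  then have "real (2 ^ (3 * Suc k)) \<le> log 2 (real n)" by (simp only: powr_realpow) simp
  then have "2 powr real (2 ^ (3 * Suc k)) \<le> real n" using n by (subst (asm) le_log_iff) auto
  then have "real (2 ^ 2 ^ (3 * Suc k)) \<le> real n" by (simp only: powr_realpow) simp
  then have *: "2 ^ 2 ^ (3 * Suc k) \<le> n" by (simp only: of_nat_le_iff)
  have "k + 2 \<le> 2 ^ 2 ^ Suc k"
  proof -
    have "k + 2 \<le> 2 ^ Suc k" using less_exp[of "Suc k"] by linarith
    also have "\<dots> \<le> 2 ^ 2 ^ Suc k"
      by (intro power_increasing) (use less_exp[of "Suc k"] in linarith, simp)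
    finally show ?thesis .
  qed
  then have "(k + 2) ^ 4 ^ Suc k \<le> (2 ^ 2 ^ Suc k) ^ 4 ^ Suc k" by (rule power_mono) simp
  also have "\<dots> = 2 ^ (2 ^ Suc k * 4 ^ Suc k)" by (rule power_mult[symmetric])
  also have "(2::nat) ^ Suc k * 4 ^ Suc k = 2 ^ (3 * Suc k)"
    by (simp only: power_mult power_mult_distrib[symmetric]) simp
  finally show ?thesis using * by simp
qed

lemma complexity_Omega_tree_steep_problem:
  assumes q: "admissible_poly q"
  shows "complexity_Omega tree_graph q steep_problem (\<lambda>n. log 2 (log 2 (real n)))"
  unfolding complexity_Omega_def
proof (intro allI impI)
  fix A assume A: "solves tree_graph q steep_problem A"
  \<comment> \<open>From \<open>x = 12\<close> on, rounding is harmless: the \<open>k\<close> chosen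
    below exceeds \<open>x / 3 - 2\<close>, which is at least \<open>x / 6\<close>.\<close>
  have "eventually (\<lambda>n. 12 \<le> log 2 (log 2 (real n))) sequentially" by real_asymp
  moreover have "eventually (\<lambda>n::nat. 2 \<le> n) sequentially" by (rule eventually_ge_at_top)
  ultimately have "eventually (\<lambda>n. ereal (1 / 6 * log 2 (log 2 (real n)))
      \<le> ereal_of_enat (round_complexity tree_graph q steep_problem A n)) sequentially"
  proof eventually_elim
    case (elim n)
    define x where "x = log 2 (log 2 (real n))"
    \<comment> \<open>The largest value with \<open>real (3 * Suc k) \<le> x\<close>, as
      \<open>tower_le\<close> asks.\<close>
    define k where "k = nat \<lfloor>x / 3\<rfloor> - 1"
    have x: "12 \<le> x" using elim by (simp add: x_def)
    then have "real (nat \<lfloor>x / 3\<rfloor>) \<le> x / 3" "x / 3 - 1 < real (nat \<lfloor>x / 3\<rfloor>)" by linarith+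
    moreover have "nat \<lfloor>x / 3\<rfloor> = Suc k" using x unfolding k_def by linarith
    ultimately have "real (Suc k) \<le> x / 3" "x / 3 - 1 < real (Suc k)" by simp_all
    then have "real (3 * Suc k) \<le> x" "x / 6 \<le> real k" using x by simp_all
    then have "(k + 2) ^ 4 ^ Suc k \<le> n" using tower_le[OF elim(2)] by (simp only: x_def)
    have "ereal (1 / 6 * x) \<le> ereal_of_enat (enat k)" using \<open>x / 6 \<le> real k\<close> by simp
    also have "\<dots> \<le> ereal_of_enat (round_complexity tree_graph q steep_problem A n)"
      using round_complexity_steep_ge[OF q A] \<open>(k + 2) ^ 4 ^ Suc k \<le> n\<close>
      by (simp only: ereal_of_enat_le_iff)
    finally show ?case by (simp only: x_def)
  qed
  then show "lower_order (round_complexity tree_graph q steep_problem A) (\<lambda>n. log 2 (log 2 (real n)))"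
    unfolding lower_order_def by (intro exI[of _ "1 / 6 :: real"]) auto
qed

text \<open>An algorithm for the larger class also works on the smaller one, and its supremum of
  rounds there ranges over fewer networks.\<close>

lemma complexity_Omega_mono:
  assumes sub: "\<And>G. C G \<Longrightarrow> C' G" and Omega: "complexity_Omega C q P g"
  shows "complexity_Omega C' q P g"
  unfolding complexity_Omega_def
proof (intro allI impI)
  fix A assume A: "solves C' q P A"
  have net: "networks C q P \<subseteq> networks C' q P" using sub by (auto simp: networks_def Let_def)
  then have "solves C q P A" using A unfolding solves_def by blast
  then have "lower_order (round_complexity C q P A) g"
    using Omega by (simp add: complexity_Omega_def)
  then obtain c where "0 < c"
    and ev: "eventually (\<lambda>n. ereal (c * g n) \<le> ereal_of_enat (round_complexity C q P A n)) sequentially"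
    unfolding lower_order_def by blast
  have "round_complexity C q P A n \<le> round_complexity C' q P A n" for n
    unfolding round_complexity_def using net by (intro SUP_subset_mono) auto
  then have "ereal_of_enat (round_complexity C q P A n) \<le> ereal_of_enat (round_complexity C' q P A n)" for n
    by (simp only: ereal_of_enat_le_iff)
  then have "eventually (\<lambda>n. ereal (c * g n) \<le> ereal_of_enat (round_complexity C' q P A n)) sequentially"
    using ev by (auto elim!: eventually_mono intro: order_trans)
  then show "lower_order (round_complexity C' q P A) g"
    unfolding lower_order_def using \<open>0 < c\<close> by blast
qed

theorem theorem2:
  shows "\<exists>P. locally_checkable P \<and>
    (\<forall>q. admissible_poly q \<longrightarrow>
       complexity_Theta (\<lambda>G. True) q P (\<lambda>n. log 2 (log 2 (real n))) \<and>
       complexity_Omega tree_graph q P (\<lambda>n. log 2 (log 2 (real n))))"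
proof (intro exI[of _ steep_problem] conjI allI impI)
  show "locally_checkable steep_problem" by (rule locally_checkable_steep_problem)
  fix q assume q: "admissible_poly q"
  show tree: "complexity_Omega tree_graph q steep_problem (\<lambda>n. log 2 (log 2 (real n)))"
    using q by (rule complexity_Omega_tree_steep_problem)
  \<comment> \<open>The upper bound is shown on all graphs, while the lower bound is inherited from
    trees.\<close>
  show "complexity_Theta (\<lambda>G. True) q steep_problem (\<lambda>n. log 2 (log 2 (real n)))"
    unfolding complexity_Theta_def
    by (intro conjI complexity_O_steep_problem complexity_Omega_mono[OF _ tree]) simp
qed

end
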